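(* Let $k$ be a field and let $R$ be a prime von Neumann regular $k$-algebra with $\dim_k(R)\le \aleph_0$. Then $R$ is both left and right primitive.
   Context: Algebras are associative and are not assumed to have an identity. A ring $R$ is von Neumann regular if for every $a\in R$ there is some $x\in R$ such that $a=axa$. A (nonzero) ring $R$ is prime if the product of any two nonzero two-sided ideals is nonzero; equivalently, for all nonzero $a,b\in R$ there is $x\in R$ with $axb\neq 0$. A ring is left (respectively right) primitive if it has a faithful simple left (respectively right) module. *)

theory Defs
  imports Complex_Main "HOL-Algebra.Module" "HOL-Library.Countable_Set"
begin

text \<open>
  Rings are types of the class \<^class>\<open>ring\<close>, which postulates associativity but no identity
  element. The types at hand are the whole rings, so properties of a ring are predicates on
  its type.
\<close>

section \<open>Algebras over a field\<close>

locale nonunital_algebra = vector_space scale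
  for scale :: "'k::field \<Rightarrow> 'a::ring \<Rightarrow> 'a" +
  assumes scale_mult_left: "scale c (x * y) = scale c x * y"
    and scale_mult_right: "scale c (x * y) = x * scale c y"
begin

text \<open>
  The library's \<^term>\<open>dim\<close> is a natural number (\<open>0\<close> in the infinite-dimensional case), so it
  cannot express that the dimension is at most aleph-zero.
\<close>

definition countable_dimension :: bool
  where "countable_dimension \<longleftrightarrow> (\<exists>B. independent B \<and> span B = UNIV \<and> countable B)"

end

section \<open>Regular and prime rings\<close>

definition von_neumann_regular :: "'a::ring itself \<Rightarrow> bool"
  where "von_neumann_regular R \<longleftrightarrow> (\<forall>a::'a. \<exists>x. a = a * x * a)"

definition two_sided_ideal :: "'a::ring set \<Rightarrow> bool"
  where "two_sided_ideal I \<longleftrightarrow>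
    0 \<in> I \<and> (\<forall>x\<in>I. \<forall>y\<in>I. x + y \<in> I) \<and> (\<forall>x\<in>I. - x \<in> I) \<and>
    (\<forall>r. \<forall>x\<in>I. r * x \<in> I \<and> x * r \<in> I)"

definition ideal_product :: "'a::ring set \<Rightarrow> 'a set \<Rightarrow> 'a set"
  where "ideal_product I J =
    {\<Sum>i<n. f i * g i |(n::nat) f g. \<forall>i<n. f i \<in> I \<and> g i \<in> J}"

definition prime_ring :: "'a::ring itself \<Rightarrow> bool"
  where "prime_ring R \<longleftrightarrow>
    (\<exists>a::'a. a \<noteq> 0) \<and>
    (\<forall>I J :: 'a set. two_sided_ideal I \<longrightarrow> two_sided_ideal J \<longrightarrow>
       I \<noteq> {0} \<longrightarrow> J \<noteq> {0} \<longrightarrow> ideal_product I J \<noteq> {0})"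

section \<open>Modules over a ring without identity\<close>

text \<open>
  The record type of HOL-Algebra modules is reused; its fields \<^const>\<open>mult\<close> and \<^const>\<open>one\<close>
  play no role. The HOL-Algebra locale for modules is not applicable, since it requires the ring
  of scalars to be commutative with identity.
\<close>

locale biadditive_action = abelian_group M
  for M :: "('a::ring, 'm) module" (structure) +
  assumes act_closed: "x \<in> carrier M \<Longrightarrow> r \<odot> x \<in> carrier M"
    and act_add_scalar: "x \<in> carrier M \<Longrightarrow> (r + s) \<odot> x = r \<odot> x \<oplus> s \<odot> x"
    and act_add: "x \<in> carrier M \<Longrightarrow> y \<in> carrier M \<Longrightarrow> r \<odot> (x \<oplus> y) = r \<odot> x \<oplus> r \<odot> y"

locale left_module = biadditive_action +
  assumes act_left: "x \<in> carrier M \<Longrightarrow> (r * s) \<odot> x = r \<odot> (s \<odot> x)"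

text \<open>In a right module \<open>r \<odot> x\<close> stands for the product of \<open>x\<close> by \<open>r\<close> on the right.\<close>

locale right_module = biadditive_action +
  assumes act_right: "x \<in> carrier M \<Longrightarrow> (r * s) \<odot> x = s \<odot> (r \<odot> x)"

definition is_submodule :: "'m set \<Rightarrow> ('a::ring, 'm) module \<Rightarrow> bool"
  where "is_submodule N M \<longleftrightarrow>
    subgroup N (add_monoid M) \<and> (\<forall>r. \<forall>x\<in>N. r \<odot>\<^bsub>M\<^esub> x \<in> N)"

text \<open>
  As usual for rings without identity, a simple module is required to have nonzero action;
  in particular it is nonzero. For a faithful module over a nonzero ring this is automatic.
\<close>

definition simple_module :: "('a::ring, 'm) module \<Rightarrow> bool"
  where "simple_module M \<longleftrightarrow>
    (\<exists>r. \<exists>x\<in>carrier M. r \<odot>\<^bsub>M\<^esub> x \<noteq> \<zero>\<^bsub>M\<^esub>) \<and>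
    (\<forall>N. is_submodule N M \<longrightarrow> N = {\<zero>\<^bsub>M\<^esub>} \<or> N = carrier M)"

definition faithful_module :: "('a::ring, 'm) module \<Rightarrow> bool"
  where "faithful_module M \<longleftrightarrow>
    (\<forall>r. (\<forall>x\<in>carrier M. r \<odot>\<^bsub>M\<^esub> x = \<zero>\<^bsub>M\<^esub>) \<longrightarrow> r = 0)"

section \<open>Primitive rings\<close>

text \<open>
  An existential quantifier cannot range over types, so the elements of the module have to be
  taken from one fixed type. Sets of ring elements suffice: a simple module is a quotient of the
  ring by a one-sided ideal. The lemmas \<open>left_primitiveI\<close> and \<open>right_primitiveI\<close> below show that
  a faithful simple module over any other type may be used just as well.
\<close>

definition left_primitive :: "'a::ring itself \<Rightarrow> bool"
  where "left_primitive R \<longleftrightarrow>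
    (\<exists>M :: ('a, 'a set) module. left_module M \<and> simple_module M \<and> faithful_module M)"

definition right_primitive :: "'a::ring itself \<Rightarrow> bool"
  where "right_primitive R \<longleftrightarrow>
    (\<exists>M :: ('a, 'a set) module. right_module M \<and> simple_module M \<and> faithful_module M)"

subsection \<open>Independence of the type of the module\<close>

context biadditive_action
begin

lemma act_zero: "r \<odot> \<zero> = \<zero>"
proof -
  have "r \<odot> \<zero> \<oplus> r \<odot> \<zero> = r \<odot> \<zero>"
    using act_add[of \<zero> \<zero> r] by simp
  then show ?thesis
    using act_closed[of \<zero> r] add.l_cancel_one' by (metis zero_closed)
qed

lemma act_zero_scalar: "x \<in> carrier M \<Longrightarrow> 0 \<odot> x = \<zero>"
  using act_add_scalar[of x 0 0] act_closed[of x 0] by (metis add.l_cancel_one' add.right_neutral)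

lemma act_neg_scalar:
  assumes "x \<in> carrier M" shows "(- r) \<odot> x = \<ominus> (r \<odot> x)"
proof -
  have "(- r) \<odot> x \<oplus> r \<odot> x = \<zero>"
    using act_add_scalar[of x "- r" r] act_zero_scalar assms by simp
  then show ?thesis
    using act_closed assms by (simp add: minus_equality)
qed

lemma act_neg:
  assumes "x \<in> carrier M" shows "r \<odot> (\<ominus> x) = \<ominus> (r \<odot> x)"
proof -
  have "r \<odot> (\<ominus> x) \<oplus> r \<odot> x = \<zero>"
    using act_add[of "\<ominus> x" x r] act_zero assms by (simp add: l_neg)
  then show ?thesis
    using act_closed assms by (simp add: minus_equality)
qed

lemma is_submoduleI:
  assumes "N \<subseteq> carrier M" "\<zero> \<in> N" "\<And>x y. x \<in> N \<Longrightarrow> y \<in> N \<Longrightarrow> x \<oplus> y \<in> N"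
    "\<And>x. x \<in> N \<Longrightarrow> \<ominus> x \<in> N" "\<And>r x. x \<in> N \<Longrightarrow> r \<odot> x \<in> N"
  shows "is_submodule N M"
  unfolding is_submodule_def
  using assms by (auto intro!: subgroup.intro simp: a_inv_def)

lemma simple_imp_cyclic:
  assumes simple: "simple_module M"
    and comp: "\<And>r s x. x \<in> carrier M \<Longrightarrow> \<exists>t. r \<odot> (s \<odot> x) = t \<odot> x"
  obtains m where "m \<in> carrier M" "carrier M = range (\<lambda>r. r \<odot> m)"
proof -
  obtain r m where m: "m \<in> carrier M" and r: "r \<odot> m \<noteq> \<zero>"
    using simple by (auto simp: simple_module_def)
  have "is_submodule (range (\<lambda>r. r \<odot> m)) M"
  proof (rule is_submoduleI)
    show "\<zero> \<in> range (\<lambda>r. r \<odot> m)"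
      using act_zero_scalar[OF m] by (metis rangeI)
    show "x \<oplus> y \<in> range (\<lambda>r. r \<odot> m)"
      if "x \<in> range (\<lambda>r. r \<odot> m)" "y \<in> range (\<lambda>r. r \<odot> m)" for x y
      using that by (auto simp: act_add_scalar[OF m, symmetric])
    show "\<ominus> x \<in> range (\<lambda>r. r \<odot> m)" if "x \<in> range (\<lambda>r. r \<odot> m)" for x
      using that by (auto simp: act_neg_scalar[OF m, symmetric])
    show "s \<odot> x \<in> range (\<lambda>r. r \<odot> m)" if "x \<in> range (\<lambda>r. r \<odot> m)" for s x
    proof -
      from that obtain u where "x = u \<odot> m"
        by blast
      then show ?thesis
        using comp[OF m, of s u] by auto
    qed
  qed (use m act_closed in auto)
  then have "carrier M = range (\<lambda>r. r \<odot> m)"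
    using simple r unfolding simple_module_def by blast
  with m that show thesis
    by blast
qed

end

definition transfer_module :: "('m \<Rightarrow> 'n) \<Rightarrow> ('a::ring, 'm) module \<Rightarrow> ('a, 'n) module"
  where "transfer_module f M =
    (let g = the_inv_into (carrier M) f in
     \<lparr>carrier = f ` carrier M, mult = undefined, one = undefined,
      zero = f \<zero>\<^bsub>M\<^esub>, add = (\<lambda>x y. f (g x \<oplus>\<^bsub>M\<^esub> g y)), smult = (\<lambda>r x. f (r \<odot>\<^bsub>M\<^esub> g x))\<rparr>)"

context biadditive_action
begin

context
  fixes f :: "'m \<Rightarrow> 'n"
  assumes inj: "inj_on f (carrier M)"
begin

lemma transfer_simps:
  "carrier (transfer_module f M) = f ` carrier M"
  "zero (transfer_module f M) = f \<zero>"
  "x \<in> carrier M \<Longrightarrow> y \<in> carrier M \<Longrightarrow> f x \<oplus>\<^bsub>transfer_module f M\<^esub> f y = f (x \<oplus> y)"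
  "x \<in> carrier M \<Longrightarrow> r \<odot>\<^bsub>transfer_module f M\<^esub> f x = f (r \<odot> x)"
  by (simp_all add: transfer_module_def Let_def the_inv_into_f_f[OF inj])

lemma transfer_abelian_group: "abelian_group (transfer_module f M)"
  by (rule abelian_groupI)
     (auto simp: transfer_simps a_ac r_neg intro!: bexI[of _ "\<ominus> x" for x])

lemma transfer_biadditive_action: "biadditive_action (transfer_module f M)"
  by (intro biadditive_action.intro transfer_abelian_group biadditive_action_axioms.intro)
     (auto simp: transfer_simps act_closed act_add act_add_scalar)

lemma transfer_faithful:
  assumes "faithful_module M" shows "faithful_module (transfer_module f M)"
  using assms inj act_closed
  by (auto simp: faithful_module_def transfer_simps inj_on_eq_iff)

lemma transfer_simple:
  assumes "simple_module M" shows "simple_module (transfer_module f M)"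
proof -
  interpret T: biadditive_action "transfer_module f M"
    by (rule transfer_biadditive_action)
  have neg: "\<ominus>\<^bsub>transfer_module f M\<^esub> (f x) = f (\<ominus> x)" if "x \<in> carrier M" for x
    using that by (intro T.minus_equality) (auto simp: transfer_simps l_neg)
  have "N = {f \<zero>} \<or> N = f ` carrier M" if N: "is_submodule N (transfer_module f M)" for N
  proof -
    from N have sg: "subgroup N (add_monoid (transfer_module f M))"
      and act: "\<And>r x. x \<in> N \<Longrightarrow> r \<odot>\<^bsub>transfer_module f M\<^esub> x \<in> N"
      by (auto simp: is_submodule_def)
    have sub: "N \<subseteq> f ` carrier M" and zero: "f \<zero> \<in> N"
      using subgroup.subset[OF sg] subgroup.one_closed[OF sg] by (auto simp: transfer_simps)
    have add: "x \<oplus>\<^bsub>transfer_module f M\<^esub> y \<in> N" if "x \<in> N" "y \<in> N" for x y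
      using subgroup.m_closed[OF sg that] by simp
    have inv: "\<ominus>\<^bsub>transfer_module f M\<^esub> x \<in> N" if "x \<in> N" for x
      using subgroup.m_inv_closed[OF sg that] by (simp add: a_inv_def)
    define L where "L = {x \<in> carrier M. f x \<in> N}"
    have N_eq: "N = f ` L"
      using sub by (auto simp: L_def)
    have "is_submodule L M"
    proof (rule is_submoduleI)
      show "x \<oplus> y \<in> L" if "x \<in> L" "y \<in> L" for x y
        using that add[of "f x" "f y"] by (auto simp: L_def transfer_simps)
      show "\<ominus> x \<in> L" if "x \<in> L" for x
        using that inv[of "f x"] by (auto simp: L_def neg)
      show "r \<odot> x \<in> L" if "x \<in> L" for r x
        using that act[of "f x" r] by (auto simp: L_def transfer_simps act_closed)
    qed (use zero in \<open>auto simp: L_def\<close>)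
    then have "L = {\<zero>} \<or> L = carrier M"
      using assms by (simp add: simple_module_def)
    with N_eq show ?thesis
      by auto
  qed
  moreover obtain r x where "x \<in> carrier M" "r \<odot> x \<noteq> \<zero>"
    using assms by (auto simp: simple_module_def)
  then have "\<exists>r. \<exists>x\<in>carrier M. f (r \<odot> x) \<noteq> f \<zero>"
    using inj act_closed by (metis inj_on_eq_iff zero_closed)
  ultimately show ?thesis
    by (auto simp: simple_module_def transfer_simps)
qed

end

lemma cyclic_embedding:
  assumes "carrier M = range (\<lambda>r. r \<odot> m)"
  shows "inj_on (\<lambda>x. {r. r \<odot> m = x}) (carrier M)"
proof (rule inj_onI)
  fix x y
  assume x: "x \<in> carrier M" and eq: "{r. r \<odot> m = x} = {r. r \<odot> m = y}"
  from x assms obtain r where "r \<odot> m = x"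
    by auto
  moreover from this have "r \<in> {r. r \<odot> m = y}"
    unfolding eq[symmetric] by simp
  ultimately show "x = y"
    by simp
qed

end

lemma left_primitiveI:
  fixes M :: "('a::ring, 'm) module"
  assumes "left_module M" "simple_module M" "faithful_module M"
  shows "left_primitive TYPE('a)"
proof -
  interpret left_module M by fact
  obtain m where m: "carrier M = range (\<lambda>r. r \<odot>\<^bsub>M\<^esub> m)"
    using simple_imp_cyclic[OF assms(2)] act_left by metis
  note inj = cyclic_embedding[OF m]
  let ?T = "transfer_module (\<lambda>x. {r. r \<odot>\<^bsub>M\<^esub> m = x}) M"
  have "left_module ?T"
    by (intro left_module.intro transfer_biadditive_action[OF inj] left_module_axioms.intro)
       (auto simp: transfer_simps[OF inj] act_closed act_left)
  then show ?thesis
    unfolding left_primitive_def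
    using transfer_simple[OF inj assms(2)] transfer_faithful[OF inj assms(3)] by blast
qed

lemma right_primitiveI:
  fixes M :: "('a::ring, 'm) module"
  assumes "right_module M" "simple_module M" "faithful_module M"
  shows "right_primitive TYPE('a)"
proof -
  interpret right_module M by fact
  obtain m where m: "carrier M = range (\<lambda>r. r \<odot>\<^bsub>M\<^esub> m)"
    using simple_imp_cyclic[OF assms(2)] act_right by metis
  note inj = cyclic_embedding[OF m]
  let ?T = "transfer_module (\<lambda>x. {r. r \<odot>\<^bsub>M\<^esub> m = x}) M"
  have "right_module ?T"
    by (intro right_module.intro transfer_biadditive_action[OF inj] right_module_axioms.intro)
       (auto simp: transfer_simps[OF inj] act_closed act_right)
  then show ?thesis
    unfolding right_primitive_def
    using transfer_simple[OF inj assms(2)] transfer_faithful[OF inj assms(3)] by blast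
qed

end

theory Submission
  imports Defs
begin

text \<open>
  Let \<open>R\<close> be the algebra. The proof has two halves.

  The first half replaces countable dimension by the existence of a countable set \<open>A\<close> of nonzero
  elements that meets every nonzero two-sided ideal. For a finite-dimensional subspace \<open>V\<close> there
  is a single nonzero element \<open>a\<close> that lies in the ideal generated by each nonzero element of \<open>V\<close>
  (\<open>common_ideal_element\<close>). This is clear if all of them generate the same ideal. If \<open>v\<close> and \<open>w\<close>
  in \<open>V\<close> generate different ideals, say \<open>w \<notin> (v)\<close>, and \<open>v = v x v\<close>, then the linear map \<open>u \<mapsto> u - v
  x u\<close> kills \<open>v\<close> but not \<open>w\<close>, so that induction on the dimension applies to its kernel on \<open>V\<close> and
  to its image; primeness combines the two elements obtained. As the finite subsets of a countable
  basis are countable in number, these elements form a set \<open>A\<close> as required.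

  The second half is an argument of Fisher and Snider. Enumerate \<open>A\<close> as \<open>a\<^sub>0, a\<^sub>1, \<dots>\<close> and choose
  nonzero idempotents \<open>e\<^sub>n \<in> (a\<^sub>n)\<close> with \<open>e\<^bsub>n+1\<^esub> \<in> e\<^sub>n R e\<^sub>n\<close>. The elements that are annihilated
  by some \<open>e\<^sub>n\<close> on the right form a left ideal without \<open>e\<^sub>0\<close>; let \<open>N\<close> be a left ideal maximal
  among those that contain it and omit \<open>e\<^sub>0\<close>. It contains every \<open>x - x e\<^sub>0\<close>, so \<open>e\<^sub>0\<close> is a right
  identity modulo \<open>N\<close> and \<open>R / N\<close> is simple. Were its annihilator nonzero, it would contain some
  \<open>e\<^sub>n\<close>, whence \<open>e\<^sub>n = e\<^sub>n e\<^sub>0 \<in> N\<close>; but \<open>e\<^sub>0 - e\<^sub>n \<in> N\<close> also, and so \<open>e\<^sub>0 \<in> N\<close>, which is false.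

  The conditions on the idempotents are left-right symmetric, so the opposite ring has the same
  sequence; its left primitivity is the right primitivity of \<open>R\<close>.
\<close>

section \<open>Ideals of prime regular rings\<close>

lemma two_sided_idealD:
  assumes "two_sided_ideal I"
  shows "0 \<in> I" "x \<in> I \<Longrightarrow> y \<in> I \<Longrightarrow> x + y \<in> I" "x \<in> I \<Longrightarrow> - x \<in> I"
    "x \<in> I \<Longrightarrow> r * x \<in> I" "x \<in> I \<Longrightarrow> x * r \<in> I" "x \<in> I \<Longrightarrow> y \<in> I \<Longrightarrow> x - y \<in> I"
proof -
  show sum: "x + y \<in> I" if "x \<in> I" "y \<in> I" for x y
    using assms that by (simp add: two_sided_ideal_def)
  show neg: "- x \<in> I" if "x \<in> I" for x
    using assms that by (simp add: two_sided_ideal_def)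
  show "x - y \<in> I" if "x \<in> I" "y \<in> I"
    using sum[OF that(1) neg[OF that(2)]] by simp
qed (use assms in \<open>simp_all add: two_sided_ideal_def\<close>)

text \<open>
  If \<open>a R b = 0\<close>, then \<open>a\<close> lies in the ideal \<open>I = {x. x R b = 0}\<close> and \<open>b\<close> in the ideal
  \<open>J = {y. I R y = 0}\<close>. Without an identity \<open>I R J = 0\<close> does not immediately give \<open>I J = 0\<close>, but
  regularity does: if \<open>y = y z y\<close> then \<open>x y = x (y z) y\<close>.
\<close>

lemma prime_regular_mult_nonzero:
  fixes a b :: "'a::ring"
  assumes "prime_ring TYPE('a)" "von_neumann_regular TYPE('a)" "a \<noteq> 0" "b \<noteq> 0"
  obtains x where "a * x * b \<noteq> 0"
proof -
  have False if zero: "\<And>x. a * x * b = 0"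
  proof -
    define I where "I = {x. \<forall>r. x * r * b = 0}"
    define J where "J = {y. \<forall>x\<in>I. \<forall>r. x * r * y = 0}"
    have ideal_I: "two_sided_ideal I"
      unfolding two_sided_ideal_def I_def by (simp add: distrib_right) (metis mult.assoc mult_zero_right)
    have ideal_J: "two_sided_ideal J"
      unfolding two_sided_ideal_def J_def
      by (simp add: distrib_left) (metis mult.assoc mult_zero_left)
    have "a \<in> I" "b \<in> J"
      using zero by (auto simp: I_def J_def)
    then have nonzero: "I \<noteq> {0}" "J \<noteq> {0}"
      using assms by auto
    have "x * y = 0" if "x \<in> I" "y \<in> J" for x y
    proof -
      obtain z where "y = y * z * y"
        using assms(2) by (auto simp: von_neumann_regular_def)
      moreover have "x * (y * z) * y = 0"
        using that by (simp add: J_def)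
      ultimately show ?thesis
        by (metis mult.assoc)
    qed
    then have "ideal_product I J = {0}"
      by (auto simp: ideal_product_def intro!: exI[of _ 0])
    then show False
      using assms(1) ideal_I ideal_J nonzero by (auto simp: prime_ring_def)
  qed
  then show thesis
    using that by blast
qed

section \<open>A countable set meeting every nonzero ideal\<close>

context nonunital_algebra
begin

text \<open>
  The subspace is given by a finite spanning set, and the induction is on its size: this spares
  the comparison of dimensions, since a smaller spanning set of the kernel and of the image
  is all that is needed.
\<close>

lemma common_ideal_element:
  assumes prime: "prime_ring TYPE('a)" and regular: "von_neumann_regular TYPE('a)"
    and "finite T"
  shows "\<exists>a. a \<noteq> 0 \<and> (\<forall>u\<in>span T. u \<noteq> 0 \<longrightarrow> (\<forall>I. two_sided_ideal I \<longrightarrow> u \<in> I \<longrightarrow> a \<in> I))"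
  using \<open>finite T\<close>
proof (induction "card T" arbitrary: T rule: less_induct)
  case less
  show ?case
  proof (cases "\<forall>v\<in>span T. \<forall>w\<in>span T. \<forall>I. v \<noteq> 0 \<longrightarrow> two_sided_ideal I \<longrightarrow> v \<in> I \<longrightarrow> w \<in> I")
    case True
    obtain c :: 'a where "c \<noteq> 0"
      using prime by (auto simp: prime_ring_def)
    with True show ?thesis
      by (cases "\<exists>w\<in>span T. w \<noteq> 0") blast+
  next
    case False
    then obtain v w I where v: "v \<in> span T" "v \<noteq> 0" and w: "w \<in> span T"
      and I: "two_sided_ideal I" "v \<in> I" "w \<notin> I"
      by blast
    obtain x where x: "v = v * x * v"
      using regular by (auto simp: von_neumann_regular_def)
    define \<phi> where "\<phi> u = u - v * x * u" for u
    have \<phi>_add: "\<phi> (u + u') = \<phi> u + \<phi> u'" for u u'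
      by (simp add: \<phi>_def distrib_left)
    have \<phi>_scale: "\<phi> (scale c u) = scale c (\<phi> u)" for c u
      by (simp add: \<phi>_def scale_mult_right[symmetric] scale_right_diff_distrib)
    have \<phi>_zero: "\<phi> 0 = 0" and \<phi>_v: "\<phi> v = 0"
      using x by (simp_all add: \<phi>_def)
    \<comment> \<open>Otherwise \<open>w = v x w\<close> would lie in the ideal \<open>I\<close>.\<close>
    have \<phi>_w: "\<phi> w \<noteq> 0"
      using I two_sided_idealD[OF I(1)] by (metis \<phi>_def eq_iff_diff_eq_0)
    \<comment> \<open>A basis \<open>B0\<close> of the kernel is extended to a basis \<open>B\<close> of the whole space. The set
      \<open>\<phi> ` (B - B0)\<close> spans the image, and both it and \<open>B0\<close> are smaller than \<open>B\<close>, because \<open>v\<close> is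
      in the kernel and \<open>w\<close> is not.\<close>
    define K where "K = {u \<in> span T. \<phi> u = 0}"
    obtain B0 where B0: "B0 \<subseteq> K" "independent B0" "K \<subseteq> span B0"
      using maximal_independent_subset[of K] by blast
    have "B0 \<subseteq> span T"
      using B0(1) by (auto simp: K_def)
    then obtain B where B: "B0 \<subseteq> B" "B \<subseteq> span T" "independent B" "span T \<subseteq> span B"
      using maximal_independent_subset_extend[of B0 "span T"] B0(2) by blast
    have fin: "finite B" and card_B: "card B \<le> card T"
      using independent_span_bound[OF less.prems B(3,2)] by auto
    have \<phi>_span: "\<phi> u \<in> span (\<phi> ` (B - B0))" if "u \<in> span T" for u
    proof -
      have "subspace {u. \<phi> u \<in> span (\<phi> ` (B - B0))}"
        by (auto simp: subspace_def \<phi>_add \<phi>_scale \<phi>_zero span_add span_scale span_zero)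
      moreover have "B \<subseteq> {u. \<phi> u \<in> span (\<phi> ` (B - B0))}"
      proof
        fix b assume "b \<in> B"
        then show "b \<in> {u. \<phi> u \<in> span (\<phi> ` (B - B0))}"
          using B0(1) by (cases "b \<in> B0") (auto simp: K_def span_zero intro: span_base)
      qed
      ultimately have "span B \<subseteq> {u. \<phi> u \<in> span (\<phi> ` (B - B0))}"
        by (intro span_minimal)
      then show ?thesis
        using that B(4) by blast
    qed
    have "B0 \<noteq> {}"
      using v \<phi>_v B0(3) by (auto simp: K_def)
    moreover have "B0 \<noteq> B"
    proof
      assume "B0 = B"
      then have "\<phi> w \<in> span (\<phi> ` {})"
        using \<phi>_span[OF w] by simp
      then show False
        using \<phi>_w by simp
    qed
    ultimately have card_B0: "card B0 < card B" and card_diff: "card (B - B0) < card B"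
      using fin B(1) by (auto intro!: psubset_card_mono)
    have "card B0 < card T"
      using card_B0 card_B by simp
    then obtain a1 where a1: "a1 \<noteq> 0"
      "\<And>u I. u \<in> span B0 \<Longrightarrow> u \<noteq> 0 \<Longrightarrow> two_sided_ideal I \<Longrightarrow> u \<in> I \<Longrightarrow> a1 \<in> I"
      using less.hyps[of B0] finite_subset[OF B(1) fin] by blast
    have "card (\<phi> ` (B - B0)) < card T"
      using card_image_le[of "B - B0" \<phi>] fin card_diff card_B by simp
    then obtain a2 where a2: "a2 \<noteq> 0"
      "\<And>u I. u \<in> span (\<phi> ` (B - B0)) \<Longrightarrow> u \<noteq> 0 \<Longrightarrow> two_sided_ideal I \<Longrightarrow> u \<in> I \<Longrightarrow> a2 \<in> I"
      using less.hyps[of "\<phi> ` (B - B0)"] fin by blast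
    obtain t where t: "a1 * t * a2 \<noteq> 0"
      using prime_regular_mult_nonzero[OF prime regular a1(1) a2(1)] .
    have "a1 * t * a2 \<in> I" if u: "u \<in> span T" "u \<noteq> 0" and I: "two_sided_ideal I" "u \<in> I" for u I
    proof (cases "\<phi> u = 0")
      case True
      then have "u \<in> span B0"
        using u B0(3) by (auto simp: K_def)
      then have "a1 \<in> I"
        using a1(2) u I by blast
      then show ?thesis
        by (intro two_sided_idealD(5)[OF I(1)])
    next
      case False
      moreover have "\<phi> u \<in> I"
        using two_sided_idealD[OF I(1)] I(2) by (simp add: \<phi>_def)
      ultimately have "a2 \<in> I"
        using a2(2) \<phi>_span[OF u(1)] I by blast
      then show ?thesis
        by (rule two_sided_idealD(4)[OF I(1)])
    qed
    with t show ?thesis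
      by blast
  qed
qed

lemma countable_set_meeting_ideals:
  assumes prime: "prime_ring TYPE('a)" and regular: "von_neumann_regular TYPE('a)"
    and "countable_dimension"
  obtains A :: "'a set" where "countable A" "0 \<notin> A"
    "\<And>I. two_sided_ideal I \<Longrightarrow> I \<noteq> {0} \<Longrightarrow> A \<inter> I \<noteq> {}"
proof -
  obtain B where B: "span B = UNIV" "countable B"
    using assms(3) by (auto simp: countable_dimension_def)
  obtain a where a: "\<And>T. finite T \<Longrightarrow> a T \<noteq> 0"
    "\<And>T u I. finite T \<Longrightarrow> u \<in> span T \<Longrightarrow> u \<noteq> 0 \<Longrightarrow> two_sided_ideal I \<Longrightarrow> u \<in> I \<Longrightarrow> a T \<in> I"
    using common_ideal_element[OF prime regular] by metis
  show thesis
  proof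
    show "countable (a ` {T. finite T \<and> T \<subseteq> B})"
      using countable_Collect_finite_subset[OF B(2)] by simp
    show "0 \<notin> a ` {T. finite T \<and> T \<subseteq> B}"
      using a(1) by force
    show "a ` {T. finite T \<and> T \<subseteq> B} \<inter> I \<noteq> {}" if I: "two_sided_ideal I" "I \<noteq> {0}" for I
    proof -
      obtain u where u: "u \<in> I" "u \<noteq> 0"
        using I two_sided_idealD(1) by blast
      have "u \<in> span B"
        using B(1) by simp
      then obtain T q where T: "finite T" "T \<subseteq> B" and "u = (\<Sum>b\<in>T. scale (q b) b)"
        unfolding span_explicit by blast
      then have "u \<in> span T"
        by (auto intro: span_sum span_scale span_base)
      then show ?thesis
        using a(2)[OF T(1)] T u I by blast
    qed
  qed
qed

end

section \<open>Decreasing idempotents\<close>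

text \<open>
  The left annihilators of the idempotents to be constructed should form an increasing chain,
  so that their union is a left ideal; hence each idempotent is to be found in the corner \<open>e R e\<close>
  of its predecessor. By primeness the ideal generated by \<open>a\<close> meets the corner nontrivially. Given
  \<open>0 \<noteq> b \<in> e R e\<close> with \<open>b = b y b\<close>, the element \<open>b y\<close> is idempotent but need not lie in
  \<open>R e\<close>; \<open>b y e\<close> does, and it is still an idempotent with \<open>(b y e) b = b\<close>.
\<close>

lemma idempotent_in_corner:
  fixes a e :: "'a::ring"
  assumes prime: "prime_ring TYPE('a)" and regular: "von_neumann_regular TYPE('a)"
    and "a \<noteq> 0" "e \<noteq> 0" "e * e = e"
  obtains f where "f \<noteq> 0" "f * f = f" "e * f = f" "f * e = f"
    "\<And>I. two_sided_ideal I \<Longrightarrow> a \<in> I \<Longrightarrow> f \<in> I"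
proof -
  obtain s where "e * s * a \<noteq> 0"
    using prime_regular_mult_nonzero[OF prime regular \<open>e \<noteq> 0\<close> \<open>a \<noteq> 0\<close>] .
  then obtain t where "e * s * a * t * e \<noteq> 0"
    using prime_regular_mult_nonzero[OF prime regular _ \<open>e \<noteq> 0\<close>] by blast
  moreover define b where "b = e * s * a * t * e"
  ultimately have "b \<noteq> 0"
    by simp
  have eb: "e * b = b" and be: "b * e = b"
    using \<open>e * e = e\<close> by (simp_all add: b_def mult.assoc[symmetric]) (simp add: mult.assoc)
  obtain y where y: "b * y * b = b"
    using regular unfolding von_neumann_regular_def by metis
  show thesis
  proof
    have fb: "b * y * e * b = b"
      using y eb by (simp add: mult.assoc)
    then show "b * y * e \<noteq> 0"
      using \<open>b \<noteq> 0\<close> by auto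
    show "b * y * e * (b * y * e) = b * y * e"
      using fb by (metis mult.assoc)
    show "e * (b * y * e) = b * y * e"
      using eb by (simp add: mult.assoc[symmetric])
    show "b * y * e * e = b * y * e"
      using \<open>e * e = e\<close> by (simp add: mult.assoc)
    show "b * y * e \<in> I" if "two_sided_ideal I" "a \<in> I" for I
      using two_sided_idealD(4,5)[OF that(1)] that(2) by (auto simp: b_def)
  qed
qed

text \<open>
  The properties of the sequence are invariant under exchanging the factors of products, so that
  they pass to the opposite ring.
\<close>

definition ideal_meeting_idempotents :: "(nat \<Rightarrow> 'a::ring) \<Rightarrow> bool"
  where "ideal_meeting_idempotents e \<longleftrightarrow>
    (\<forall>n. e n \<noteq> 0) \<and> (\<forall>m n. m \<le> n \<longrightarrow> e m * e n = e n \<and> e n * e m = e n) \<and>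
    (\<forall>I. two_sided_ideal I \<longrightarrow> I \<noteq> {0} \<longrightarrow> (\<exists>n. e n \<in> I))"

lemma ex_ideal_meeting_idempotents:
  fixes A :: "'a::ring set"
  assumes prime: "prime_ring TYPE('a)" and regular: "von_neumann_regular TYPE('a)"
    and "countable A" "0 \<notin> A"
    and meets: "\<And>I. two_sided_ideal I \<Longrightarrow> I \<noteq> {0} \<Longrightarrow> A \<inter> I \<noteq> {}"
  obtains e :: "nat \<Rightarrow> 'a" where "ideal_meeting_idempotents e"
proof -
  obtain c :: 'a where "c \<noteq> 0"
    using prime by (auto simp: prime_ring_def)
  then have "(UNIV :: 'a set) \<noteq> {0}"
    by blast
  then have "A \<noteq> {}"
    using meets[of UNIV] by (auto simp: two_sided_ideal_def)
  define a where "a = from_nat_into A"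
  have range_a: "range a = A"
    using range_from_nat_into[OF \<open>A \<noteq> {}\<close> \<open>countable A\<close>] by (simp add: a_def)
  have a_nonzero: "a n \<noteq> 0" for n
    using \<open>0 \<notin> A\<close> range_a by (metis rangeI)
  define P where "P n e \<longleftrightarrow> e \<noteq> 0 \<and> e * e = e \<and>
    (\<forall>I. two_sided_ideal I \<longrightarrow> a n \<in> I \<longrightarrow> e \<in> I)" for n e
  have "\<exists>e. \<forall>n. P n (e n) \<and> (e n * e (Suc n) = e (Suc n) \<and> e (Suc n) * e n = e (Suc n))"
  proof (rule dependent_nat_choice)
    obtain y where y: "a 0 * y * a 0 = a 0"
      using regular unfolding von_neumann_regular_def by metis
    have "a 0 * y \<noteq> 0" "a 0 * y * (a 0 * y) = a 0 * y"
      using y a_nonzero[of 0] by (auto simp: mult.assoc[symmetric])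
    then show "\<exists>e. P 0 e"
      by (auto simp: P_def two_sided_idealD(5) intro!: exI[of _ "a 0 * y"])
  next
    fix e n assume "P n e"
    then show "\<exists>f. P (Suc n) f \<and> (e * f = f \<and> f * e = f)"
      using idempotent_in_corner[OF prime regular a_nonzero[of "Suc n"], of e]
      unfolding P_def by metis
  qed
  then obtain e where P: "\<And>n. P n (e n)"
    and decreasing: "\<And>n. e n * e (Suc n) = e (Suc n)" "\<And>n. e (Suc n) * e n = e (Suc n)"
    by blast
  have "e m * e n = e n \<and> e n * e m = e n" if "m \<le> n" for m n
    using that
  proof (induction n rule: dec_induct)
    case base
    then show ?case
      using P by (simp add: P_def)
  next
    case (step n)
    then show ?case
      using decreasing[of n]
      by (metis mult.assoc)
  qed
  moreover have "\<exists>n. e n \<in> I" if "two_sided_ideal I" "I \<noteq> {0}" for I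
    using meets[OF that] that P unfolding P_def range_a[symmetric] by blast
  ultimately have "ideal_meeting_idempotents e"
    using P by (auto simp: ideal_meeting_idempotents_def P_def)
  then show thesis
    by (rule that)
qed

section \<open>Quotients by left ideals\<close>

definition left_ideal :: "'a::ring set \<Rightarrow> bool"
  where "left_ideal N \<longleftrightarrow>
    0 \<in> N \<and> (\<forall>x\<in>N. \<forall>y\<in>N. x + y \<in> N) \<and> (\<forall>x\<in>N. - x \<in> N) \<and> (\<forall>r. \<forall>x\<in>N. r * x \<in> N)"

definition residue_class :: "'a::ring set \<Rightarrow> 'a \<Rightarrow> 'a set"
  where "residue_class N x = {y. y - x \<in> N}"

definition quotient_module :: "'a::ring set \<Rightarrow> ('a, 'a set) module"
  where "quotient_module N =
    \<lparr>carrier = range (residue_class N), mult = undefined, one = undefined,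
     zero = N, add = (\<lambda>X Y. {x + y |x y. x \<in> X \<and> y \<in> Y}),
     smult = (\<lambda>r X. {y. \<exists>x\<in>X. y - r * x \<in> N})\<rparr>"

context
  fixes N :: "'a::ring set"
  assumes N: "left_ideal N"
begin

lemma left_ideal_closed:
  "0 \<in> N" "x \<in> N \<Longrightarrow> y \<in> N \<Longrightarrow> x + y \<in> N" "x \<in> N \<Longrightarrow> - x \<in> N" "x \<in> N \<Longrightarrow> r * x \<in> N"
  "x \<in> N \<Longrightarrow> y \<in> N \<Longrightarrow> x - y \<in> N"
proof -
  show sum: "x + y \<in> N" if "x \<in> N" "y \<in> N" for x y
    using N that by (simp add: left_ideal_def)
  show neg: "- x \<in> N" if "x \<in> N" for x
    using N that by (simp add: left_ideal_def)
  show "x - y \<in> N" if "x \<in> N" "y \<in> N"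
    using sum[OF that(1) neg[OF that(2)]] by simp
qed (use N in \<open>simp_all add: left_ideal_def\<close>)

lemma residue_class_eq_iff: "residue_class N x = residue_class N y \<longleftrightarrow> x - y \<in> N"
proof
  assume "residue_class N x = residue_class N y"
  moreover have "x \<in> residue_class N x"
    using left_ideal_closed(1) by (simp add: residue_class_def)
  ultimately show "x - y \<in> N"
    by (simp add: residue_class_def)
next
  assume xy: "x - y \<in> N"
  have "z - x \<in> N \<longleftrightarrow> z - y \<in> N" for z
    using left_ideal_closed(2)[OF _ xy, of "z - x"] left_ideal_closed(5)[OF _ xy, of "z - y"] by auto
  then show "residue_class N x = residue_class N y"
    by (simp add: residue_class_def)
qed

lemma quotient_module_simps:
  "carrier (quotient_module N) = range (residue_class N)"
  "\<zero>\<^bsub>quotient_module N\<^esub> = residue_class N 0"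
  "residue_class N x \<oplus>\<^bsub>quotient_module N\<^esub> residue_class N y = residue_class N (x + y)"
  "r \<odot>\<^bsub>quotient_module N\<^esub> residue_class N x = residue_class N (r * x)"
proof -
  show "residue_class N x \<oplus>\<^bsub>quotient_module N\<^esub> residue_class N y = residue_class N (x + y)"
  proof -
    have "\<exists>u v. z = u + v \<and> u - x \<in> N \<and> v - y \<in> N" if "z - (x + y) \<in> N" for z
      using that left_ideal_closed(1)
      by (intro exI[of _ x] exI[of _ "z - x"]) (simp add: diff_diff_eq)
    moreover have "u + v - (x + y) \<in> N" if "u - x \<in> N" "v - y \<in> N" for u v
      using left_ideal_closed(2)[OF that] by (simp add: algebra_simps)
    ultimately show ?thesis
      by (auto simp: quotient_module_def residue_class_def)
  qed
  show "r \<odot>\<^bsub>quotient_module N\<^esub> residue_class N x = residue_class N (r * x)"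
  proof -
    have "y - r * x \<in> N" if "z - x \<in> N" "y - r * z \<in> N" for y z
      using left_ideal_closed(2)[OF that(2) left_ideal_closed(4)[OF that(1), of r]]
      by (simp add: algebra_simps)
    moreover have "\<exists>z. z - x \<in> N \<and> y - r * z \<in> N" if "y - r * x \<in> N" for y
      using that left_ideal_closed(1) by (intro exI[of _ x]) simp
    ultimately show ?thesis
      by (auto simp: quotient_module_def residue_class_def)
  qed
qed (simp_all add: quotient_module_def residue_class_def)

lemma left_module_quotient: "left_module (quotient_module N)"
proof (intro left_module.intro biadditive_action.intro)
  show "abelian_group (quotient_module N)"
  proof (rule abelian_groupI)
    show "\<exists>y\<in>carrier (quotient_module N). y \<oplus>\<^bsub>quotient_module N\<^esub> x = \<zero>\<^bsub>quotient_module N\<^esub>"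
      if x: "x \<in> carrier (quotient_module N)" for x
    proof -
      obtain r where "x = residue_class N r"
        using x by (auto simp: quotient_module_simps)
      then show ?thesis
        by (intro bexI[of _ "residue_class N (- r)"]) (simp_all add: quotient_module_simps)
    qed
  qed (auto simp: quotient_module_simps ac_simps)
  show "biadditive_action_axioms (quotient_module N)"
    by unfold_locales (auto simp: quotient_module_simps distrib_left distrib_right)
  show "left_module_axioms (quotient_module N)"
    by unfold_locales (auto simp: quotient_module_simps mult.assoc)
qed

text \<open>
  The submodules of the quotient correspond to the left ideals above \<open>N\<close>, so simplicity amounts
  to maximality of \<open>N\<close>. Maximality alone does not exclude a zero action on the quotient, which is
  why a product outside \<open>N\<close> is required.
\<close>

lemma simple_quotientI:
  assumes "r * x \<notin> N" and maximal: "\<And>L. left_ideal L \<Longrightarrow> N \<subset> L \<Longrightarrow> L = UNIV"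
  shows "simple_module (quotient_module N)"
proof -
  interpret Q: left_module "quotient_module N"
    by (rule left_module_quotient)
  have "S = {\<zero>\<^bsub>quotient_module N\<^esub>} \<or> S = carrier (quotient_module N)"
    if S: "is_submodule S (quotient_module N)" for S
  proof -
    from S have sg: "subgroup S (add_monoid (quotient_module N))"
      and act: "\<And>r x. x \<in> S \<Longrightarrow> r \<odot>\<^bsub>quotient_module N\<^esub> x \<in> S"
      by (auto simp: is_submodule_def)
    have neg: "\<ominus>\<^bsub>quotient_module N\<^esub> (residue_class N x) = residue_class N (- x)" for x
      by (intro Q.minus_equality) (auto simp: quotient_module_simps)
    define L where "L = {x. residue_class N x \<in> S}"
    have S_eq: "S = residue_class N ` L"
      using subgroup.subset[OF sg] by (auto simp: L_def quotient_module_simps)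
    have "left_ideal L"
      unfolding left_ideal_def
    proof (intro conjI ballI allI)
      show "0 \<in> L"
        using subgroup.one_closed[OF sg] by (simp add: L_def quotient_module_simps)
      show "x + y \<in> L" if "x \<in> L" "y \<in> L" for x y
        using subgroup.m_closed[OF sg, of "residue_class N x" "residue_class N y"] that
        by (simp add: L_def quotient_module_simps)
      show "- x \<in> L" if "x \<in> L" for x
        using subgroup.m_inv_closed[OF sg, of "residue_class N x"] that
        by (simp add: L_def a_inv_def[symmetric] neg)
      show "r * x \<in> L" if "x \<in> L" for r x
        using act[of "residue_class N x" r] that by (simp add: L_def quotient_module_simps)
    qed
    have "N \<subseteq> L"
    proof
      fix x assume "x \<in> N"
      then have "residue_class N x = residue_class N 0"
        by (simp add: residue_class_eq_iff)
      then show "x \<in> L"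
        using \<open>left_ideal L\<close> by (simp add: L_def left_ideal_def)
    qed
    then consider "L = N" | "L = UNIV"
      using maximal[OF \<open>left_ideal L\<close>] by blast
    then show ?thesis
    proof cases
      case 1
      have "residue_class N ` N = (\<lambda>_. residue_class N 0) ` N"
        by (rule image_cong) (simp_all add: residue_class_eq_iff)
      then have "S = {residue_class N 0}"
        using S_eq 1 left_ideal_closed(1) by (auto simp: image_constant_conv)
      then show ?thesis
        by (simp add: quotient_module_simps)
    next
      case 2
      then show ?thesis
        using S_eq by (simp add: quotient_module_simps)
    qed
  qed
  moreover have "residue_class N (r * x) \<noteq> residue_class N 0"
    using assms(1) by (simp add: residue_class_eq_iff)
  ultimately show ?thesis
    unfolding simple_module_def by (auto simp: quotient_module_simps)
qed

lemma faithful_quotientI: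
  assumes "\<And>r. (\<And>x. r * x \<in> N) \<Longrightarrow> r = 0"
  shows "faithful_module (quotient_module N)"
  using assms by (auto simp: faithful_module_def quotient_module_simps residue_class_eq_iff)

lemma two_sided_ideal_annihilator: "two_sided_ideal {r. \<forall>x. r * x \<in> N}"
  unfolding two_sided_ideal_def
  using left_ideal_closed by (auto simp: distrib_right mult.assoc)

end

section \<open>Left primitivity from the idempotents\<close>

lemma ex_maximal_left_ideal_avoiding:
  fixes c :: "'a::ring"
  assumes "left_ideal L" "c \<notin> L"
  obtains N where "left_ideal N" "L \<subseteq> N" "c \<notin> N"
    "\<And>N'. left_ideal N' \<Longrightarrow> N \<subset> N' \<Longrightarrow> c \<in> N'"
proof -
  define F where "F = {N. left_ideal N \<and> L \<subseteq> N \<and> c \<notin> N}"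
  have "\<exists>N\<in>F. \<forall>X\<in>F. N \<subseteq> X \<longrightarrow> X = N"
  proof (rule subset_Zorn_nonempty)
    show "F \<noteq> {}"
      using assms by (auto simp: F_def)
    fix C assume C: "C \<noteq> {}" "subset.chain F C"
    have "C \<subseteq> F" and lin: "\<And>X Y. X \<in> C \<Longrightarrow> Y \<in> C \<Longrightarrow> X \<subseteq> Y \<or> Y \<subseteq> X"
      using C(2) by (auto simp: subset_chain_def)
    then have ideal: "left_ideal X" and "L \<subseteq> X" and "c \<notin> X" if "X \<in> C" for X
      using that by (auto simp: F_def)
    have "left_ideal (\<Union>C)"
      unfolding left_ideal_def
    proof (intro conjI ballI allI)
      show "0 \<in> \<Union>C"
        using C(1) left_ideal_closed(1)[OF ideal] by blast
      show "x + y \<in> \<Union>C" if xy: "x \<in> \<Union>C" "y \<in> \<Union>C" for x y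
      proof -
        obtain X Y where XY: "X \<in> C" "Y \<in> C" "x \<in> X" "y \<in> Y"
          using xy by blast
        then obtain Z where "Z \<in> C" "x \<in> Z" "y \<in> Z"
          using lin[of X Y] by blast
        then show ?thesis
          using left_ideal_closed(2)[OF ideal] by blast
      qed
      show "- x \<in> \<Union>C" if "x \<in> \<Union>C" for x
        using that left_ideal_closed(3)[OF ideal] by blast
      show "r * x \<in> \<Union>C" if "x \<in> \<Union>C" for r x
        using that left_ideal_closed(4)[OF ideal] by blast
    qed
    then show "\<Union>C \<in> F"
      using C(1) \<open>\<And>X. X \<in> C \<Longrightarrow> L \<subseteq> X\<close> \<open>\<And>X. X \<in> C \<Longrightarrow> c \<notin> X\<close> by (auto simp: F_def)
  qed
  then obtain N where "N \<in> F" "\<And>X. X \<in> F \<Longrightarrow> N \<subseteq> X \<Longrightarrow> X = N"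
    by blast
  then show thesis
    using that[of N] by (auto simp: F_def)
qed

text \<open>
  A left ideal maximal among those avoiding \<open>e 0\<close> is maximal outright, because \<open>e 0\<close> is a right
  identity modulo the ideal: as soon as a larger left ideal contains \<open>e 0\<close>, it contains every
  \<open>x = (x - x * e 0) + x * e 0\<close>.
\<close>

lemma left_primitive_of_idempotents:
  fixes e :: "nat \<Rightarrow> 'a::ring"
  assumes "ideal_meeting_idempotents e"
  shows "left_primitive TYPE('a)"
proof -
  have nonzero: "\<And>n. e n \<noteq> 0"
    and mult: "\<And>m n. m \<le> n \<Longrightarrow> e m * e n = e n" "\<And>m n. m \<le> n \<Longrightarrow> e n * e m = e n"
    and meets: "\<And>I. two_sided_ideal I \<Longrightarrow> I \<noteq> {0} \<Longrightarrow> \<exists>n. e n \<in> I"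
    using assms by (auto simp: ideal_meeting_idempotents_def)
  define L where "L = {r. \<exists>n. r * e n = 0}"
  have later: "r * e n = 0" if "r * e m = 0" "m \<le> n" for r m n
    using that mult(1)[OF that(2)] by (metis mult.assoc mult_zero_left)
  have "left_ideal L"
    unfolding left_ideal_def
  proof (intro conjI ballI allI)
    show "x + y \<in> L" if xy: "x \<in> L" "y \<in> L" for x y
    proof -
      obtain m n where "x * e m = 0" "y * e n = 0"
        using xy by (auto simp: L_def)
      then have "(x + y) * e (max m n) = 0"
        using later[of x m "max m n"] later[of y n "max m n"] by (simp add: distrib_right)
      then show ?thesis
        by (auto simp: L_def)
    qed
    show "r * x \<in> L" if "x \<in> L" for r x
    proof -
      obtain n where "x * e n = 0"
        using \<open>x \<in> L\<close> by (auto simp: L_def)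
      then have "r * x * e n = 0"
        by (simp add: mult.assoc)
      then show ?thesis
        by (auto simp: L_def)
    qed
  qed (auto simp: L_def)
  moreover have "e 0 \<notin> L"
    using nonzero mult(1)[of 0] by (auto simp: L_def)
  ultimately obtain N where N: "left_ideal N" "L \<subseteq> N" "e 0 \<notin> N"
    and maximal: "\<And>N'. left_ideal N' \<Longrightarrow> N \<subset> N' \<Longrightarrow> e 0 \<in> N'"
    using ex_maximal_left_ideal_avoiding by blast
  have modular: "x - x * e n \<in> N" for x n
  proof -
    have "(x - x * e n) * e n = 0"
      using mult(1)[of n n] by (simp add: left_diff_distrib mult.assoc)
    then show ?thesis
      using N(2) by (auto simp: L_def)
  qed
  have "simple_module (quotient_module N)"
  proof (rule simple_quotientI[OF N(1)])
    show "e 0 * e 0 \<notin> N"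
      using mult(1)[of 0 0] N(3) by simp
    fix N' assume N': "left_ideal N'" "N \<subset> N'"
    have "x \<in> N'" for x
    proof -
      have "x * e 0 \<in> N'"
        using maximal[OF N'] left_ideal_closed(4)[OF N'(1)] by blast
      moreover have "x - x * e 0 \<in> N'"
        using modular N'(2) by blast
      ultimately show ?thesis
        using left_ideal_closed(2)[OF N'(1), of "x - x * e 0" "x * e 0"] by simp
    qed
    then show "N' = UNIV"
      by blast
  qed
  moreover have "faithful_module (quotient_module N)"
  proof (rule faithful_quotientI[OF N(1)], rule ccontr)
    fix r assume "\<And>x. r * x \<in> N" "r \<noteq> 0"
    then have "{r. \<forall>x. r * x \<in> N} \<noteq> {0}"
      by blast
    then obtain n where "e n * e 0 \<in> N"
      using meets[OF two_sided_ideal_annihilator[OF N(1)]] by blast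
    then have "e n \<in> N"
      using mult(2)[of 0 n] by simp
    moreover have "e 0 - e n \<in> N"
      using modular[of "e 0" n] mult(1)[of 0 n] by simp
    ultimately show False
      using left_ideal_closed(2)[OF N(1), of "e 0 - e n" "e n"] N(3) by simp
  qed
  ultimately show ?thesis
    using left_primitiveI[OF left_module_quotient[OF N(1)]] by blast
qed

section \<open>The opposite ring\<close>

datatype 'a opposite = Opposite (unopposite: 'a)

instantiation opposite :: (ring) ring
begin

definition "0 = Opposite 0"
definition "x + y = Opposite (unopposite x + unopposite y)"
definition "x - y = Opposite (unopposite x - unopposite y)"
definition "- x = Opposite (- unopposite x)"
definition "x * y = Opposite (unopposite y * unopposite x)"

instance
  by standard
     (simp_all add: zero_opposite_def plus_opposite_def minus_opposite_def uminus_opposite_def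
       times_opposite_def algebra_simps)

end

lemmas opposite_simps = zero_opposite_def plus_opposite_def minus_opposite_def
  uminus_opposite_def times_opposite_def

lemma two_sided_ideal_unopposite:
  fixes I :: "'a::ring opposite set"
  assumes "two_sided_ideal I"
  shows "two_sided_ideal (unopposite ` I)"
proof -
  have mem: "x \<in> unopposite ` I \<longleftrightarrow> Opposite x \<in> I" for x
    by (metis image_iff opposite.collapse opposite.sel)
  have "Opposite (x + y) = Opposite x + Opposite y" "Opposite (- x) = - Opposite x"
    "Opposite (x * y) = Opposite y * Opposite x" "Opposite (0 :: 'a) = 0" for x y :: 'a
    by (simp_all add: opposite_simps)
  then show ?thesis
    using two_sided_idealD(1-5)[OF assms] by (simp add: two_sided_ideal_def Ball_def mem)
qed

lemma ideal_meeting_idempotents_opposite: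
  assumes "ideal_meeting_idempotents e"
  shows "ideal_meeting_idempotents (\<lambda>n. Opposite (e n))"
proof -
  have "\<exists>n. Opposite (e n) \<in> I" if I: "two_sided_ideal I" "I \<noteq> {0}" for I
  proof -
    have "unopposite ` I \<noteq> {0}"
    proof
      assume "unopposite ` I = {0}"
      then have "I = {0}"
        using I(1) two_sided_idealD(1)[OF I(1)]
        by (auto simp: zero_opposite_def) (metis image_eqI opposite.collapse singletonD)
      then show False
        using I(2) by simp
    qed
    then obtain n where "e n \<in> unopposite ` I"
      using assms two_sided_ideal_unopposite[OF I(1)]
      unfolding ideal_meeting_idempotents_def by blast
    then show ?thesis
      by (metis imageE opposite.collapse)
  qed
  then show ?thesis
    using assms by (auto simp: ideal_meeting_idempotents_def opposite_simps)
qed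

text \<open>The same abelian group, viewed as a right module over the original ring.\<close>

definition opposite_module :: "('a opposite, 'm) module \<Rightarrow> ('a, 'm) module"
  where "opposite_module M =
    \<lparr>carrier = carrier M, mult = mult M, one = one M, zero = zero M, add = add M,
     smult = (\<lambda>r. smult M (Opposite r))\<rparr>"

lemma right_primitive_of_left_primitive_opposite:
  assumes "left_primitive TYPE('a::ring opposite)"
  shows "right_primitive TYPE('a)"
proof -
  obtain M :: "('a opposite, 'a opposite set) module"
    where M: "left_module M" "simple_module M" "faithful_module M"
    using assms by (auto simp: left_primitive_def)
  interpret left_module M
    by fact
  have simps: "carrier (opposite_module M) = carrier M" "zero (opposite_module M) = zero M"
    "add (opposite_module M) = add M"
    "smult (opposite_module M) = (\<lambda>r. smult M (Opposite r))"
    by (simp_all add: opposite_module_def)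
  have all_opposite: "(\<forall>r. P r) \<longleftrightarrow> (\<forall>r. P (Opposite r))" for P :: "'a opposite \<Rightarrow> bool"
    by (metis opposite.collapse)
  have ex_opposite: "(\<exists>r. P r) \<longleftrightarrow> (\<exists>r. P (Opposite r))" for P :: "'a opposite \<Rightarrow> bool"
    by (metis opposite.collapse)
  have "abelian_group (opposite_module M)"
    by (rule abelian_groupI) (auto simp: simps a_ac l_neg intro!: bexI[of _ "\<ominus>\<^bsub>M\<^esub> x" for x])
  moreover have "biadditive_action_axioms (opposite_module M)"
    by unfold_locales
       (simp_all add: simps act_closed act_add act_add_scalar[symmetric] plus_opposite_def)
  moreover have "right_module_axioms (opposite_module M)"
    by unfold_locales (simp add: simps act_left[symmetric] times_opposite_def)
  ultimately have "right_module (opposite_module M)"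
    by (intro right_module.intro biadditive_action.intro)
  moreover have "simple_module (opposite_module M)"
    using M(2) by (simp add: simple_module_def is_submodule_def subgroup_def m_inv_def simps all_opposite ex_opposite)
  moreover have "faithful_module (opposite_module M)"
    using M(3) by (simp add: faithful_module_def simps all_opposite zero_opposite_def)
  ultimately show ?thesis
    by (rule right_primitiveI)
qed

section \<open>Primitivity\<close>

theorem theorem1p1:
  fixes scale :: "'k::field \<Rightarrow> 'a::ring \<Rightarrow> 'a"
  assumes "nonunital_algebra scale"
    and "prime_ring TYPE('a)"
    and "von_neumann_regular TYPE('a)"
    and "nonunital_algebra.countable_dimension scale"
  shows "left_primitive TYPE('a) \<and> right_primitive TYPE('a)"
proof -
  obtain A :: "'a set" where "countable A" "0 \<notin> A"
    "\<And>I. two_sided_ideal I \<Longrightarrow> I \<noteq> {0} \<Longrightarrow> A \<inter> I \<noteq> {}"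
    using nonunital_algebra.countable_set_meeting_ideals[OF assms] by blast
  then obtain e :: "nat \<Rightarrow> 'a" where e: "ideal_meeting_idempotents e"
    using ex_ideal_meeting_idempotents[OF assms(2,3)] by blast
  from left_primitive_of_idempotents[OF e]
    left_primitive_of_idempotents[OF ideal_meeting_idempotents_opposite[OF e]]
  show ?thesis
    by (intro conjI right_primitive_of_left_primitive_opposite)
qed

end
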